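(* Let $\mu$ be an eigenvalue of the $1$-Laplacian of a connected graph $G$. Then $$\mathrm{am}(\mu)=\dim\mathrm{span}(\mathcal K_\mu).$$
   Context: $G=(V,E)$ is a finite simple undirected connected graph, $V=\{1,\dots,n\}$, $n\ge 2$; $d_i$ is the degree of $i$; $\mathrm{vol}(A)=\sum_{i\in A}d_i$; $X=\{\vec x\in\mathbb R^n:\sum_i d_i|x_i|=1\}$. $\mathrm{Sgn}(t)=\{1\}$ if $t>0$, $\{-1\}$ if $t<0$, $[-1,1]$ if $t=0$. A nonzero $\vec x\in\mathbb R^n$ is an eigenvector of the $1$-Laplacian with eigenvalue $\mu$ (and $(\mu,\vec x)$ is an eigenpair) if there exist $z_{ij}\in\mathrm{Sgn}(x_i-x_j)$ with $z_{ji}=-z_{ij}$ (for all adjacent $i,j$) such that $\sum_{j\sim i}z_{ij}\in\mu d_i\,\mathrm{Sgn}(x_i)$ for all $i\in V$. Eigenvectors are normalized to lie in $X$, and $\mathcal K_\mu$ is the set of eigenvectors with eigenvalue $\mu$. For nonempty $D\subset V$, $\hat{\vec 1}_D$ is the indicator vector of $D$ divided by $\mathrm{vol}(D)$. A system $\{\vec\phi_1,\dots,\vec\phi_m\}$ of eigenvectors with eigenvalue $\mu$, where $\vec\phi_j=\hat{\vec 1}_{D_j}$ for $j=1,\dots,m$, is called a fundamental eigenvector system for $\mu$ if for every eigenpair $(\mu,\vec\psi)$ there exists $(a_1,\dots,a_m)\in\mathbb R^m$ such that $\vec\psi=\sum_{i=1}^m a_i\vec\phi_i$ and $\sum_{i=1}^m|a_i|=1$,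 and no $\vec\phi_j$ can be expressed linearly by the other eigenvectors in the system. The collection of all fundamental eigenvector systems for $\mu$ is partially ordered by inclusion, and its maximal elements are called maximal fundamental eigenvector systems. The algebraic multiplicity $\mathrm{am}(\mu)$ is the largest cardinality of a maximal fundamental eigenvector system for $\mu$.
   Formalization: It is additionally assumed that a maximal fundamental eigenvector system for μ exists, so that am(μ) is defined; this can fail, e.g. for the complete graph on four vertices with μ = 2/3. *)

theory Defs
  imports "HOL-Analysis.Analysis"
begin

text \<open>The vertex set is the finite index type \<open>'n\<close> of \<open>real ^ 'n\<close>; a graph is given by its
  adjacency relation.\<close>

definition connected_simple_graph :: "('n::finite \<Rightarrow> 'n \<Rightarrow> bool) \<Rightarrow> bool" where
  "connected_simple_graph E \<longleftrightarrow> symp E \<and> irreflp E \<and> (\<forall>i j. E\<^sup>*\<^sup>* i j)"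

definition vdegree :: "('n::finite \<Rightarrow> 'n \<Rightarrow> bool) \<Rightarrow> 'n \<Rightarrow> nat" where
  "vdegree E i = card {j. E i j}"

definition vol :: "('n::finite \<Rightarrow> 'n \<Rightarrow> bool) \<Rightarrow> 'n set \<Rightarrow> nat" where
  "vol E A = (\<Sum>i\<in>A. vdegree E i)"

definition X_sphere :: "('n::finite \<Rightarrow> 'n \<Rightarrow> bool) \<Rightarrow> (real ^ 'n) set" where
  "X_sphere E = {x. (\<Sum>i\<in>UNIV. real (vdegree E i) * \<bar>x $ i\<bar>) = 1}"

definition Sgn :: "real \<Rightarrow> real set" where
  "Sgn t = (if t > 0 then {1} else if t < 0 then {-1} else {-1..1})"

definition eigenpair1 :: "('n::finite \<Rightarrow> 'n \<Rightarrow> bool) \<Rightarrow> real \<Rightarrow> real ^ 'n \<Rightarrow> bool" where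
  "eigenpair1 E \<mu> x \<longleftrightarrow> x \<noteq> 0 \<and>
     (\<exists>z :: 'n \<Rightarrow> 'n \<Rightarrow> real.
        (\<forall>i j. E i j \<longrightarrow> z i j \<in> Sgn (x $ i - x $ j) \<and> z j i = - z i j) \<and>
        (\<forall>i. (\<Sum>j | E i j. z i j) \<in> (\<lambda>s. \<mu> * real (vdegree E i) * s) ` Sgn (x $ i)))"

definition eigenvalue1 :: "('n::finite \<Rightarrow> 'n \<Rightarrow> bool) \<Rightarrow> real \<Rightarrow> bool" where
  "eigenvalue1 E \<mu> \<longleftrightarrow> (\<exists>x. eigenpair1 E \<mu> x)"

definition K_eig :: "('n::finite \<Rightarrow> 'n \<Rightarrow> bool) \<Rightarrow> real \<Rightarrow> (real ^ 'n) set" where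
  "K_eig E \<mu> = {x \<in> X_sphere E. eigenpair1 E \<mu> x}"

definition hat_indicator :: "('n::finite \<Rightarrow> 'n \<Rightarrow> bool) \<Rightarrow> 'n set \<Rightarrow> real ^ 'n" where
  "hat_indicator E D = (\<chi> i. if i \<in> D then 1 / real (vol E D) else 0)"

text \<open>A system is a set of vectors. It is automatically finite, as there are only finitely many
  normalized indicator vectors, so the sums below are genuine. Eigenvectors are taken
  normalized, i.e. in \<open>X_sphere\<close>.\<close>

definition fundamental_system ::
    "('n::finite \<Rightarrow> 'n \<Rightarrow> bool) \<Rightarrow> real \<Rightarrow> (real ^ 'n) set \<Rightarrow> bool" where
  "fundamental_system E \<mu> \<Phi> \<longleftrightarrow>
     \<Phi> \<subseteq> K_eig E \<mu> \<and>
     (\<forall>\<phi>\<in>\<Phi>. \<exists>D. D \<noteq> {} \<and> \<phi> = hat_indicator E D) \<and>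
     (\<forall>\<psi>\<in>K_eig E \<mu>. \<exists>a :: real ^ 'n \<Rightarrow> real.
        \<psi> = (\<Sum>\<phi>\<in>\<Phi>. a \<phi> *\<^sub>R \<phi>) \<and> (\<Sum>\<phi>\<in>\<Phi>. \<bar>a \<phi>\<bar>) = 1) \<and>
     (\<forall>\<phi>\<in>\<Phi>. \<phi> \<notin> span (\<Phi> - {\<phi>}))"

definition maximal_fundamental_system ::
    "('n::finite \<Rightarrow> 'n \<Rightarrow> bool) \<Rightarrow> real \<Rightarrow> (real ^ 'n) set \<Rightarrow> bool" where
  "maximal_fundamental_system E \<mu> \<Phi> \<longleftrightarrow>
     fundamental_system E \<mu> \<Phi> \<and> (\<forall>\<Psi>. fundamental_system E \<mu> \<Psi> \<and> \<Phi> \<subseteq> \<Psi> \<longrightarrow> \<Psi> = \<Phi>)"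

text \<open>The maximum is meaningful only if a fundamental system for \<open>\<mu>\<close> exists, which can fail: on the
  complete graph with four vertices, the eigenvectors for \<open>\<mu> = 2/3\<close> include the normalized
  indicators of all six vertex pairs; these are linearly dependent, but none of them is a
  combination of the other five with absolute coefficient sum 1.\<close>

definition am :: "('n::finite \<Rightarrow> 'n \<Rightarrow> bool) \<Rightarrow> real \<Rightarrow> nat" where
  "am E \<mu> = Max (card ` {\<Phi>. maximal_fundamental_system E \<mu> \<Phi>})"

end

theory Submission
  imports Defs
begin

text \<open>A fundamental system is a basis of the span of \<open>K_eig E \<mu>\<close>: its members
  are eigenvectors, the non-expressibility clause is linear independence, and the expansion clause
  puts every eigenvector in its span. By \<open>card_fundamental_system\<close>, all fundamental
  systems, maximal or not, therefore have the same cardinality, and the maximum defining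
  \<open>am\<close> is taken over a single number.\<close>

lemma card_fundamental_system:
  fixes E :: "'n::finite \<Rightarrow> 'n \<Rightarrow> bool"
  assumes "fundamental_system E \<mu> \<Phi>"
  shows "card \<Phi> = dim (span (K_eig E \<mu>))"
proof -
  have sub: "\<Phi> \<subseteq> K_eig E \<mu>" and indep: "independent \<Phi>"
    using assms by (auto simp: fundamental_system_def dependent_def)
  have "K_eig E \<mu> \<subseteq> span \<Phi>"
  proof
    fix \<psi> assume "\<psi> \<in> K_eig E \<mu>"
    then obtain a :: "real ^ 'n \<Rightarrow> real" where "\<psi> = (\<Sum>\<phi>\<in>\<Phi>. a \<phi> *\<^sub>R \<phi>)"
      using assms unfolding fundamental_system_def by blast
    then show "\<psi> \<in> span \<Phi>"
      by (simp add: span_sum span_scale span_base)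
  qed
  \<comment> \<open>\<open>\<Phi>\<close> is now a basis chosen inside \<open>K_eig E \<mu>\<close>
    itself, so its size is the dimension.\<close>
  with sub indep have "dim (K_eig E \<mu>) = card \<Phi>"
    by (intro dim_unique) auto
  then show ?thesis
    by simp
qed

theorem theorem11:
  fixes E :: "'n::finite \<Rightarrow> 'n \<Rightarrow> bool" and \<mu> :: real
  assumes "CARD('n) \<ge> 2"
    and "connected_simple_graph E"
    and "eigenvalue1 E \<mu>"
    and am_defined: "\<exists>\<Phi>. maximal_fundamental_system E \<mu> \<Phi>"
  shows "am E \<mu> = dim (span (K_eig E \<mu>))"
proof -
  let ?S = "{\<Phi>. maximal_fundamental_system E \<mu> \<Phi>}"
  have "card \<Phi> = dim (span (K_eig E \<mu>))" if "\<Phi> \<in> ?S" for \<Phi>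
    using that card_fundamental_system unfolding maximal_fundamental_system_def by blast
  then have "card ` ?S = (\<lambda>_. dim (span (K_eig E \<mu>))) ` ?S"
    by (rule image_cong[OF refl])
  \<comment> \<open>A constant image is a singleton only over a nonempty family;
    \<open>am_defined\<close> provides a member and so excludes the unspecified value
    \<open>Max {}\<close>.\<close>
  also have "\<dots> = {dim (span (K_eig E \<mu>))}"
    using am_defined by blast
  finally show ?thesis
    unfolding am_def by (simp only: Max_singleton)
qed

end
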